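(* Let $A,B,C$ be real functions and let $H=A(x)R+B(x)T^+R+C(x)$. (1) For $a\in\mathbb{R}$ let $x_s=-\frac14+(-1)^s\left(\frac14+a+\frac s2\right)$, $s\in\mathbb{Z}$. Then $-x_{2s}=x_{2s-1}$ and $-1-x_{2s}=x_{2s+1}$ for all $s\in\mathbb Z$, every sequence satisfying these two conditions is of this form, and for every function $f$ and every $s\in\mathbb{Z}$ such that $A,B,C$ are defined at $x_s$, $$(Hf)(x_s)=\xi_sf(x_{s+1})+\eta_sf(x_s)+\zeta_sf(x_{s-1}),$$ with $\eta_s=C(x_s)$, $\xi_s=B(x_s)$ and $\zeta_s=A(x_s)$ for even $s$, and $\xi_s=A(x_s)$ and $\zeta_s=B(x_s)$ for odd $s$. (2) For $b\in\mathbb{R}$ let $y_s=-\frac14+(-1)^s\left(\frac14+b-\frac s2\right)$, $s\in\mathbb{Z}$. Then $-y_{2s}=y_{2s+1}$ and $-1-y_{2s}=y_{2s-1}$ for all $s\in\mathbb Z$, every sequence satisfying these two conditions is of this form, and for every function $f$ and every $s\in\mathbb Z$ such that $A,B,C$ are defined at $y_s$, $$(Hf)(y_s)=\xi_sf(y_{s+1})+\eta_sf(y_s)+\zeta_sf(y_{s-1}),$$ with $\eta_s=C(y_s)$, $\xi_s=A(y_s)$ and $\zeta_s=B(y_s)$ for even $s$, and $\xi_s=B(y_s)$ and $\zeta_s=A(y_s)$ for odd $s$.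
   Context: $Rf(x)=f(-x)$ and $T^+Rf(x)=f(-x-1)$. The sequences $(x_s)$ and $(y_s)$ are called the Bannai-Ito grids of the first and second type. The case $A=-F$, $B=G$, $C=F-G$ with $F(x)=\frac{(x-\rho_1)(x-\rho_2)}{2x}$, $G(x)=\frac{(x-r_1+1/2)(x-r_2+1/2)}{2x+1}$ is the Bannai-Ito operator. *)

theory Defs
  imports Complex_Main
begin

definition reflection :: "(real \<Rightarrow> real) \<Rightarrow> real \<Rightarrow> real" where
  "reflection f = (\<lambda>x. f (- x))"

definition fwd_shift :: "(real \<Rightarrow> real) \<Rightarrow> real \<Rightarrow> real" where
  "fwd_shift f = (\<lambda>x. f (x + 1))"

(* The operator A(x) R + B(x) T^+ R + C(x). The coefficients may have poles, as in the
   Bannai-Ito case, so they are partial functions; H f is defined exactly where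
   A, B and C all are. *)
definition refl_op ::
  "(real \<rightharpoonup> real) \<Rightarrow> (real \<rightharpoonup> real) \<Rightarrow> (real \<rightharpoonup> real) \<Rightarrow> (real \<Rightarrow> real) \<Rightarrow> (real \<rightharpoonup> real)" where
  "refl_op A B C f = (\<lambda>x.
     if x \<in> dom A \<inter> dom B \<inter> dom C
     then Some (the (A x) * reflection f x + the (B x) * fwd_shift (reflection f) x
                + the (C x) * f x)
     else None)"

definition BI_grid1 :: "real \<Rightarrow> int \<Rightarrow> real" where
  "BI_grid1 a s = - 1/4 + (- 1) powi s * (1/4 + a + real_of_int s / 2)"

definition BI_grid2 :: "real \<Rightarrow> int \<Rightarrow> real" where
  "BI_grid2 b s = - 1/4 + (- 1) powi s * (1/4 + b - real_of_int s / 2)"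

end

theory Submission
  imports Defs
begin

text \<open>
  The maps \<open>x \<mapsto> - x\<close> and \<open>x \<mapsto> - 1 - x\<close> are involutions of the line, and their composition is the
  unit translation. The first grid is an orbit of the group they generate, numbered so that the
  two involutions alternately join consecutive points: the first joins the positions \<open>2k - 1\<close> and
  \<open>2k\<close>, the second \<open>2k\<close> and \<open>2k + 1\<close>. Hence \<open>R\<close> and \<open>T\<^sup>+R\<close> evaluate \<open>f\<close> at the two neighbours of
  a grid point, in an order that depends on the parity of its index, which is the three-term
  relation (\<open>refl_op_grid1\<close>). Conversely, applying both involutions in turn gives
  \<open>x\<^sub>2\<^sub>k\<^sub>+\<^sub>2 = x\<^sub>2\<^sub>k + 1\<close>, so the sequence is determined by \<open>x\<^sub>0\<close>, which plays the role of the parameter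
  (\<open>grid1_unique\<close>).

  The second grid is the first one traversed backwards (\<open>grid2_eq_grid1\<close>), so every claim about it
  is a claim about the first grid with \<open>s\<close> replaced by \<open>- s\<close>, which interchanges \<open>\<xi>\<^sub>s\<close> and \<open>\<zeta>\<^sub>s\<close>.
\<close>

lemma grid1_even: "even s \<Longrightarrow> BI_grid1 a s = a + of_int s / 2"
  by (simp add: BI_grid1_def power_int_minus_left)

lemma grid1_odd: "odd s \<Longrightarrow> BI_grid1 a s = - 1 / 2 - a - of_int s / 2"
  by (simp add: BI_grid1_def power_int_minus_left)

lemma grid2_eq_grid1: "BI_grid2 b s = BI_grid1 b (- s)"
  by (cases "even s") (simp_all add: BI_grid1_def BI_grid2_def)

lemma neg_grid1: "- BI_grid1 a s = BI_grid1 a (if even s then s - 1 else s + 1)"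
  by (cases "even s") (simp_all add: grid1_even grid1_odd field_simps)

lemma neg_shift_grid1: "- 1 - BI_grid1 a s = BI_grid1 a (if even s then s + 1 else s - 1)"
  by (cases "even s") (simp_all add: grid1_even grid1_odd field_simps)

lemma grid1_unique:
  fixes x :: "int \<Rightarrow> real"
  assumes neg: "\<And>s. - x (2 * s) = x (2 * s - 1)"
    and neg_shift: "\<And>s. - 1 - x (2 * s) = x (2 * s + 1)"
  shows "x s = BI_grid1 (x 0) s"
proof -
  have step: "x (2 * (k + 1)) = x (2 * k) + 1" for k
    using neg[of "k + 1"] neg_shift[of k] by (simp add: add.commute)
  have evens: "x (2 * k) = x 0 + of_int k" for k
  proof (induction k rule: int_induct[where k = 0])
    case base
    show ?case by simp
  next
    case (step1 i)
    then show ?case using step[of i] by simp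
  next
    case (step2 i)
    then show ?case using step[of "i - 1"] by simp
  qed
  show ?thesis
  proof (cases "even s")
    case True
    then obtain k where "s = 2 * k" by (elim evenE)
    then show ?thesis by (simp add: evens grid1_even)
  next
    case False
    then obtain k where "s = 2 * k + 1" by (elim oddE)
    moreover have "x (2 * k + 1) = - 1 - x 0 - of_int k"
      using neg_shift[of k] evens[of k] by linarith
    ultimately show ?thesis by (simp add: grid1_odd field_simps)
  qed
qed

lemma refl_op_eq:
  assumes "x \<in> dom A \<inter> dom B \<inter> dom C"
  shows "refl_op A B C f x
    = Some (the (A x) * f (- x) + the (B x) * f (- 1 - x) + the (C x) * f x)"
proof -
  have "- (x + 1) = - 1 - x" by simp
  with assms show ?thesis
    by (simp only: refl_op_def fwd_shift_def reflection_def if_True)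
qed

lemma refl_op_grid1:
  assumes "BI_grid1 a s \<in> dom A \<inter> dom B \<inter> dom C"
  shows "refl_op A B C f (BI_grid1 a s)
    = Some ((if even s then the (B (BI_grid1 a s)) else the (A (BI_grid1 a s)))
              * f (BI_grid1 a (s + 1))
          + the (C (BI_grid1 a s)) * f (BI_grid1 a s)
          + (if even s then the (A (BI_grid1 a s)) else the (B (BI_grid1 a s)))
              * f (BI_grid1 a (s - 1)))"
  by (simp add: refl_op_eq[OF assms] neg_grid1 neg_shift_grid1)

theorem mainTheorem10:
  fixes A B C :: "real \<rightharpoonup> real"
  shows
    "((\<forall>a. \<forall>s. - BI_grid1 a (2 * s) = BI_grid1 a (2 * s - 1)
              \<and> - 1 - BI_grid1 a (2 * s) = BI_grid1 a (2 * s + 1))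
      \<and> (\<forall>x :: int \<Rightarrow> real.
           (\<forall>s. - x (2 * s) = x (2 * s - 1) \<and> - 1 - x (2 * s) = x (2 * s + 1))
             \<longrightarrow> (\<exists>a. \<forall>s. x s = BI_grid1 a s))
      \<and> (\<forall>a f s. BI_grid1 a s \<in> dom A \<inter> dom B \<inter> dom C \<longrightarrow>
           (let x = BI_grid1 a;
                \<xi> = (if even s then the (B (x s)) else the (A (x s)));
                \<eta> = the (C (x s));
                \<zeta> = (if even s then the (A (x s)) else the (B (x s)))
            in refl_op A B C f (x s)
                 = Some (\<xi> * f (x (s + 1)) + \<eta> * f (x s) + \<zeta> * f (x (s - 1))))))
     \<and>
     ((\<forall>b. \<forall>s. - BI_grid2 b (2 * s) = BI_grid2 b (2 * s + 1)
              \<and> - 1 - BI_grid2 b (2 * s) = BI_grid2 b (2 * s - 1))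
      \<and> (\<forall>y :: int \<Rightarrow> real.
           (\<forall>s. - y (2 * s) = y (2 * s + 1) \<and> - 1 - y (2 * s) = y (2 * s - 1))
             \<longrightarrow> (\<exists>b. \<forall>s. y s = BI_grid2 b s))
      \<and> (\<forall>b f s. BI_grid2 b s \<in> dom A \<inter> dom B \<inter> dom C \<longrightarrow>
           (let y = BI_grid2 b;
                \<xi> = (if even s then the (A (y s)) else the (B (y s)));
                \<eta> = the (C (y s));
                \<zeta> = (if even s then the (B (y s)) else the (A (y s)))
            in refl_op A B C f (y s)
                 = Some (\<xi> * f (y (s + 1)) + \<eta> * f (y s) + \<zeta> * f (y (s - 1))))))"
proof (intro conjI allI impI)
  fix a s
  show "- BI_grid1 a (2 * s) = BI_grid1 a (2 * s - 1)" by (simp add: neg_grid1)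
  show "- 1 - BI_grid1 a (2 * s) = BI_grid1 a (2 * s + 1)" by (simp add: neg_shift_grid1)
next
  fix x :: "int \<Rightarrow> real"
  assume "\<forall>s. - x (2 * s) = x (2 * s - 1) \<and> - 1 - x (2 * s) = x (2 * s + 1)"
  then show "\<exists>a. \<forall>s. x s = BI_grid1 a s" using grid1_unique[of x] by blast
next
  fix a f s
  assume "BI_grid1 a s \<in> dom A \<inter> dom B \<inter> dom C"
  then show "let x = BI_grid1 a;
                \<xi> = (if even s then the (B (x s)) else the (A (x s)));
                \<eta> = the (C (x s));
                \<zeta> = (if even s then the (A (x s)) else the (B (x s)))
            in refl_op A B C f (x s)
                 = Some (\<xi> * f (x (s + 1)) + \<eta> * f (x s) + \<zeta> * f (x (s - 1)))"
    unfolding Let_def by (rule refl_op_grid1)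
next
  fix b s
  show "- BI_grid2 b (2 * s) = BI_grid2 b (2 * s + 1)"
    by (simp add: grid2_eq_grid1 neg_grid1)
  show "- 1 - BI_grid2 b (2 * s) = BI_grid2 b (2 * s - 1)"
    by (simp add: grid2_eq_grid1 neg_shift_grid1)
next
  fix y :: "int \<Rightarrow> real"
  assume y: "\<forall>s. - y (2 * s) = y (2 * s + 1) \<and> - 1 - y (2 * s) = y (2 * s - 1)"
  have "y (- s) = BI_grid1 (y 0) s" for s
    using grid1_unique[of "\<lambda>s. y (- s)" s] y[rule_format, of "- k" for k] by simp
  then have "y s = BI_grid2 (y 0) s" for s
    by (metis grid2_eq_grid1 minus_minus)
  then show "\<exists>b. \<forall>s. y s = BI_grid2 b s" by blast
next
  fix b f s
  assume "BI_grid2 b s \<in> dom A \<inter> dom B \<inter> dom C"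
  then have "BI_grid1 b (- s) \<in> dom A \<inter> dom B \<inter> dom C"
    by (simp only: grid2_eq_grid1)
  moreover have "- (s + 1) = - s - 1" "- (s - 1) = - s + 1" by simp_all
  ultimately show "let y = BI_grid2 b;
                \<xi> = (if even s then the (A (y s)) else the (B (y s)));
                \<eta> = the (C (y s));
                \<zeta> = (if even s then the (B (y s)) else the (A (y s)))
            in refl_op A B C f (y s)
                 = Some (\<xi> * f (y (s + 1)) + \<eta> * f (y s) + \<zeta> * f (y (s - 1)))"
    by (simp only: Let_def grid2_eq_grid1 refl_op_grid1 even_minus) (simp only: ac_simps)
qed

end
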